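(* Consider a SAP instance, let $\mathcal{A}_{opt}$ be an optimal (maximum-profit feasible) seminar assignment, and for $b\in B$ let $p_{opt}(b)=\sum_{i\in\mathcal{A}_{opt}^{-1}(b)}p(i,b)$. Let $b_1,b_2,b_3$ be three seminars with highest values of $p_{opt}$, and let $S^*$ be the seminar selection with $S^*(b)=|\mathcal{A}_{opt}^{-1}(b)|$ for $b\in\{b_1,b_2,b_3\}$ and $S^*(b)=0$ otherwise. Then the algorithm GREEDY run with initial seminar selection $S_0=S^*$ outputs a feasible seminar assignment whose profit is at least $(1-e^{-1})\,p(\mathcal{A}_{opt})$.
   Context: SAP instance: finite set $B$ of seminars, finite set $I$ of students, for each $b\in B$ a set $K_b\subseteq\mathbb{N}$ of allowable numbers of students with $0\in K_b$, profits $p(i,b)\ge 0$. A seminar assignment is $\mathcal{A}:J\to B$ with $J\subseteq I$, feasible if $|\mathcal{A}^{-1}(b)|\in K_b$ for all $b$, with profit $p(\mathcal{A})=\sum_{i\in J}p(i,\mathcal{A}(i))$. A seminar selection is $S:B\to\mathbb{N}$ with $S(b)\in K_b$ for all $b$; it is feasible if $\sum_b S(b)\le |I|$. $p(S)$ is the maximum profit of an assignment assigning exactly $S(b)$ students to each $b$, and $\mathcal{A}_S$ denotes such an optimal assignment. The cost is $c(S)=\sum_b S(b)$. Write $T\succ S$ if $T(b)\ge S(b)$ for all $b$ and $T(b)>S(b)$ for some $b$; $inc(S)$ is the set of feasible selections $T\succ S$ with $T(b)>S(b)$ for exactly one $b$. Algorithm GREEDY with feasible initial selection $S_0$: set $i=0$;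 while $inc(S_i)\neq\emptyset$, let $S_{i+1}$ be an element of $inc(S_i)$ maximizing $\frac{p(S')-p(S_i)}{c(S')-c(S_i)}$ over $S'\in inc(S_i)$ and increase $i$ by one. Let $\mathcal{A}_1=\mathcal{A}_{S_i}$ for the final $i$. Let $\mathcal{A}_2$ be a feasible assignment of maximum profit among feasible assignments that assign students to only a single seminar $b$, where $b$ ranges over seminars with $S_0(b)=0$. Output whichever of $\mathcal{A}_1,\mathcal{A}_2$ has larger profit. *)

theory Defs
  imports Complex_Main "HOL-Library.FuncSet"
begin

record ('i, 'b) sap =
  students :: "'i set"
  seminars :: "'b set"
  sizes :: "'b \<Rightarrow> nat set"
  gain :: "'i \<Rightarrow> 'b \<Rightarrow> real"

definition sap_instance :: "('i, 'b) sap \<Rightarrow> bool" where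
  "sap_instance P \<longleftrightarrow>
     finite (students P) \<and> finite (seminars P) \<and>
     (\<forall>b\<in>seminars P. 0 \<in> sizes P b) \<and>
     (\<forall>i\<in>students P. \<forall>b\<in>seminars P. 0 \<le> gain P i b)"

text \<open>An assignment \<open>J \<rightarrow> B\<close> with \<open>J \<subseteq> I\<close> is a partial map whose domain is \<open>J\<close>.\<close>

definition assignment :: "('i, 'b) sap \<Rightarrow> ('i \<rightharpoonup> 'b) \<Rightarrow> bool" where
  "assignment P A \<longleftrightarrow> dom A \<subseteq> students P \<and> ran A \<subseteq> seminars P"

definition assigned :: "('i \<rightharpoonup> 'b) \<Rightarrow> 'b \<Rightarrow> 'i set" where
  "assigned A b = {i. A i = Some b}"

definition feasible_assignment :: "('i, 'b) sap \<Rightarrow> ('i \<rightharpoonup> 'b) \<Rightarrow> bool" where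
  "feasible_assignment P A \<longleftrightarrow>
     assignment P A \<and> (\<forall>b\<in>seminars P. card (assigned A b) \<in> sizes P b)"

definition profit :: "('i, 'b) sap \<Rightarrow> ('i \<rightharpoonup> 'b) \<Rightarrow> real" where
  "profit P A = (\<Sum>i\<in>dom A. gain P i (the (A i)))"

definition seminar_profit :: "('i, 'b) sap \<Rightarrow> ('i \<rightharpoonup> 'b) \<Rightarrow> 'b \<Rightarrow> real" where
  "seminar_profit P A b = (\<Sum>i\<in>assigned A b. gain P i b)"

definition optimal_assignment :: "('i, 'b) sap \<Rightarrow> ('i \<rightharpoonup> 'b) \<Rightarrow> bool" where
  "optimal_assignment P A \<longleftrightarrow> is_arg_max (profit P) (feasible_assignment P) A"

text \<open>Selections are extensional functions, so that they are determined by their values on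
  the seminars.\<close>

definition selection :: "('i, 'b) sap \<Rightarrow> ('b \<Rightarrow> nat) \<Rightarrow> bool" where
  "selection P S \<longleftrightarrow> S \<in> (\<Pi>\<^sub>E b\<in>seminars P. sizes P b)"

definition cost :: "('i, 'b) sap \<Rightarrow> ('b \<Rightarrow> nat) \<Rightarrow> nat" where
  "cost P S = (\<Sum>b\<in>seminars P. S b)"

definition feasible_selection :: "('i, 'b) sap \<Rightarrow> ('b \<Rightarrow> nat) \<Rightarrow> bool" where
  "feasible_selection P S \<longleftrightarrow> selection P S \<and> cost P S \<le> card (students P)"

definition realizes :: "('i, 'b) sap \<Rightarrow> ('b \<Rightarrow> nat) \<Rightarrow> ('i \<rightharpoonup> 'b) \<Rightarrow> bool" where
  "realizes P S A \<longleftrightarrow> assignment P A \<and> (\<forall>b\<in>seminars P. card (assigned A b) = S b)"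

text \<open>For an instance \<open>P\<close> and a feasible \<open>S\<close>, the set under \<^const>\<open>Max\<close> is finite and nonempty.\<close>

definition selection_profit :: "('i, 'b) sap \<Rightarrow> ('b \<Rightarrow> nat) \<Rightarrow> real" where
  "selection_profit P S = Max {profit P A | A. realizes P S A}"

definition strictly_extends :: "('i, 'b) sap \<Rightarrow> ('b \<Rightarrow> nat) \<Rightarrow> ('b \<Rightarrow> nat) \<Rightarrow> bool" where
  "strictly_extends P T S \<longleftrightarrow>
     (\<forall>b\<in>seminars P. S b \<le> T b) \<and> (\<exists>b\<in>seminars P. S b < T b)"

definition inc :: "('i, 'b) sap \<Rightarrow> ('b \<Rightarrow> nat) \<Rightarrow> ('b \<Rightarrow> nat) set" where
  "inc P S = {T. feasible_selection P T \<and> strictly_extends P T S \<and>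
                 (\<exists>!b. b \<in> seminars P \<and> S b < T b)}"

definition incremental_ratio :: "('i, 'b) sap \<Rightarrow> ('b \<Rightarrow> nat) \<Rightarrow> ('b \<Rightarrow> nat) \<Rightarrow> real" where
  "incremental_ratio P S T =
     (selection_profit P T - selection_profit P S) / (real (cost P T) - real (cost P S))"

text \<open>The algorithm is modelled as a nondeterministic one, since it leaves open which of several
  maximizers is chosen.\<close>

definition greedy_step :: "('i, 'b) sap \<Rightarrow> ('b \<Rightarrow> nat) \<Rightarrow> ('b \<Rightarrow> nat) \<Rightarrow> bool" where
  "greedy_step P S T \<longleftrightarrow> is_arg_max (incremental_ratio P S) (\<lambda>T. T \<in> inc P S) T"

definition greedy_final :: "('i, 'b) sap \<Rightarrow> ('b \<Rightarrow> nat) \<Rightarrow> ('b \<Rightarrow> nat) \<Rightarrow> bool" where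
  "greedy_final P S0 S \<longleftrightarrow> (greedy_step P)\<^sup>*\<^sup>* S0 S \<and> inc P S = {}"

definition greedy_terminates :: "('i, 'b) sap \<Rightarrow> ('b \<Rightarrow> nat) \<Rightarrow> bool" where
  "greedy_terminates P S0 \<longleftrightarrow>
     \<not> (\<exists>S :: nat \<Rightarrow> 'b \<Rightarrow> nat. S 0 = S0 \<and> (\<forall>n. greedy_step P (S n) (S (Suc n))))"

definition single_seminar_assignment ::
  "('i, 'b) sap \<Rightarrow> ('b \<Rightarrow> nat) \<Rightarrow> ('i \<rightharpoonup> 'b) \<Rightarrow> bool" where
  "single_seminar_assignment P S0 A \<longleftrightarrow>
     feasible_assignment P A \<and> (\<exists>b\<in>seminars P. S0 b = 0 \<and> ran A \<subseteq> {b})"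

text \<open>If no seminar satisfies \<open>S0 b = 0\<close>, there is no candidate for the second assignment \<open>A2\<close>,
  and the algorithm outputs \<open>A1\<close>. In case of equal profits either assignment may be output.\<close>

definition greedy_output ::
  "('i, 'b) sap \<Rightarrow> ('b \<Rightarrow> nat) \<Rightarrow> ('i \<rightharpoonup> 'b) \<Rightarrow> bool" where
  "greedy_output P S0 A \<longleftrightarrow>
     (\<exists>S A1. greedy_final P S0 S \<and> is_arg_max (profit P) (realizes P S) A1 \<and>
        (if \<exists>b\<in>seminars P. S0 b = 0
         then \<exists>A2. is_arg_max (profit P) (single_seminar_assignment P S0) A2 \<and>
                is_arg_max (profit P) (\<lambda>A'. A' \<in> {A1, A2}) A
         else A = A1))"

end

theory Submission imports Defs begin

text \<open>
  Allowing at most, rather than exactly, \<open>S b\<close> students in seminar \<open>b\<close> does not change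
  \<open>p(S)\<close>, and \<open>p\<close> has diminishing returns: raising several coordinates of \<open>S\<close> to those of an
  assignment \<open>Y\<close> gains no more than the sum of the gains of raising them one at a time. So as
  long as each seminar can still be raised to its optimal size, every greedy step shrinks the gap to
  the optimum exponentially in its cost.

  Let \<open>b\<close> be the first seminar whose raise to its optimal size does not fit (if there is none,
  greedy covers the optimum). Compare with the optimum \<^emph>\<open>without\<close> \<open>b\<close>, whose profit is
  \<open>OPT - q\<close>, where \<open>q = p_opt(b)\<close>. Since \<open>b\<close> does not fit, greedy has already spent at least
  the total optimal size \<open>L\<close> of the seminars other than \<open>b, b1, b2, b3\<close>, so with \<open>G = p(S0)\<close> its
  profit is at least \<open>(1 - 1/e) (OPT - q) + G/e\<close>. As \<open>q \<le> G/3\<close> and \<open>e \<le> 3\<close>, this is at least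
  \<open>(1 - 1/e) OPT\<close>; the single-seminar assignment is not needed for the bound.
\<close>

section \<open>Switching between assignments, and size bounds in place of exact sizes\<close>

definition mix :: "'i set \<Rightarrow> ('i \<rightharpoonup> 'b) \<Rightarrow> ('i \<rightharpoonup> 'b) \<Rightarrow> ('i \<rightharpoonup> 'b)" where
  "mix C Y X = (\<lambda>i. if i \<in> C then Y i else X i)"

text \<open>The default 0 for unassigned students makes every profit a sum over the fixed set
  \<open>students P\<close>, so two assignments can be compared student by student.\<close>

definition value_of :: "('i, 'b) sap \<Rightarrow> ('i \<rightharpoonup> 'b) \<Rightarrow> 'i \<Rightarrow> real" where
  "value_of P A i = (case A i of None \<Rightarrow> 0 | Some b \<Rightarrow> gain P i b)"

definition capped :: "('i, 'b) sap \<Rightarrow> ('b \<Rightarrow> nat) \<Rightarrow> ('i \<rightharpoonup> 'b) \<Rightarrow> bool" where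
  "capped P S A \<longleftrightarrow> assignment P A \<and> (\<forall>b\<in>seminars P. card (assigned A b) \<le> S b)"

lemma realizes_capped: "realizes P S A \<Longrightarrow> capped P S A"
  by (simp add: realizes_def capped_def)

lemma capped_mono: "capped P S A \<Longrightarrow> (\<And>b. b \<in> seminars P \<Longrightarrow> S b \<le> T b) \<Longrightarrow> capped P T A"
  unfolding capped_def by (meson order_trans)

lemma assignment_mix:
  "assignment P X \<Longrightarrow> assignment P Y \<Longrightarrow> assignment P (mix C Y X)"
  by (auto simp: assignment_def mix_def dom_def ran_def split: if_splits)

context
  fixes P :: "('i, 'b) sap"
  assumes inst: "sap_instance P"
begin

section \<open>Finiteness, and profits as sums over seminars or students\<close>

lemma finite_students: "finite (students P)" and finite_seminars: "finite (seminars P)"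
  using inst by (auto simp: sap_instance_def)

lemma gain_nonneg: "i \<in> students P \<Longrightarrow> b \<in> seminars P \<Longrightarrow> 0 \<le> gain P i b"
  using inst by (auto simp: sap_instance_def)

lemma finite_assignments: "finite {A. assignment P A}"
proof -
  have "{A. assignment P A} \<subseteq> (\<Union>J\<in>Pow (students P). {A. dom A = J \<and> ran A \<subseteq> seminars P})"
    by (auto simp: assignment_def)
  moreover have "finite (\<Union>J\<in>Pow (students P). {A. dom A = J \<and> ran A \<subseteq> seminars P})"
    using finite_students finite_seminars
    by (auto intro!: finite_set_of_finite_maps intro: finite_subset)
  ultimately show ?thesis by (rule finite_subset)
qed

lemma finite_assigned: "assignment P A \<Longrightarrow> finite (assigned A b)"
  using finite_students by (auto simp: assignment_def assigned_def dom_def intro: finite_subset)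

lemma dom_eq_UN_assigned: "assignment P A \<Longrightarrow> dom A = (\<Union>b\<in>seminars P. assigned A b)"
  by (auto simp: assignment_def assigned_def ran_def)

lemma card_dom: "assignment P A \<Longrightarrow> card (dom A) = (\<Sum>b\<in>seminars P. card (assigned A b))"
  unfolding dom_eq_UN_assigned
  by (rule card_UN_disjoint) (auto simp: finite_seminars finite_assigned, auto simp: assigned_def)

lemma profit_eq_sum_seminar_profit:
  assumes "assignment P A"
  shows "profit P A = (\<Sum>b\<in>seminars P. seminar_profit P A b)"
proof -
  have "profit P A = (\<Sum>b\<in>seminars P. \<Sum>i\<in>assigned A b. gain P i (the (A i)))"
    unfolding profit_def dom_eq_UN_assigned[OF assms]
    by (rule sum.UNION_disjoint)
      (use assms in \<open>auto simp: finite_seminars finite_assigned\<close>, auto simp: assigned_def)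
  also have "\<dots> = (\<Sum>b\<in>seminars P. seminar_profit P A b)"
    unfolding seminar_profit_def by (intro sum.cong refl) (auto simp: assigned_def)
  finally show ?thesis .
qed

lemma profit_eq_sum_value_of:
  assumes "assignment P A"
  shows "profit P A = (\<Sum>i\<in>students P. value_of P A i)"
  unfolding profit_def
  using assms finite_students
  by (intro sum.mono_neutral_cong_left) (auto simp: assignment_def value_of_def split: option.splits)

lemma seminar_profit_nonneg:
  "assignment P A \<Longrightarrow> b \<in> seminars P \<Longrightarrow> 0 \<le> seminar_profit P A b"
  unfolding seminar_profit_def
  by (intro sum_nonneg gain_nonneg) (auto simp: assignment_def assigned_def dom_def)

section \<open>Selection profits under size bounds\<close>

text \<open>While some seminar is below its bound, fewer than \<open>cost P T\<close> students are
  assigned, so an unassigned one is left to fill the place; gains are nonnegative, so filling up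
  never loses profit.\<close>

lemma capped_imp_realizes:
  assumes "capped P T Z" "cost P T \<le> card (students P)"
  shows "\<exists>Z'. realizes P T Z' \<and> profit P Z \<le> profit P Z'"
  using assms(1)
proof (induction "cost P T - card (dom Z)" arbitrary: Z rule: less_induct)
  case less
  have asg: "assignment P Z" and le: "\<And>b. b \<in> seminars P \<Longrightarrow> card (assigned Z b) \<le> T b"
    using less.prems by (auto simp: capped_def)
  show ?case
  proof (cases "realizes P T Z")
    case False
    then obtain b where b: "b \<in> seminars P" "card (assigned Z b) < T b"
      using asg le unfolding realizes_def by (meson le_neq_implies_less)
    have lt: "card (dom Z) < cost P T"
      unfolding card_dom[OF asg] cost_def using le b finite_seminars
      by (intro sum_strict_mono_ex1) auto
    then obtain i where i: "i \<in> students P" "i \<notin> dom Z"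
      using assms(2) asg unfolding assignment_def
      by (metis card_mono[OF finite_students] le_trans not_le subset_antisym subsetI less_irrefl)
    let ?Z = "Z(i \<mapsto> b)"
    have asg': "assignment P ?Z"
      using asg i b by (auto simp: assignment_def ran_def)
    have fin: "finite (dom Z)"
      using asg finite_students by (auto simp: assignment_def intro: finite_subset)
    have "assigned ?Z c = (if c = b then insert i (assigned Z c) else assigned Z c)" for c
      using i by (auto simp: assigned_def)
    then have "capped P T ?Z"
      using asg' le b i finite_assigned[OF asg] by (auto simp: capped_def card_insert_if Suc_leI)
    moreover have "cost P T - card (dom ?Z) < cost P T - card (dom Z)"
      using lt i fin by simp
    ultimately obtain Z' where Z': "realizes P T Z'" "profit P ?Z \<le> profit P Z'"
      using less.hyps by blast
    have "profit P ?Z = gain P i b + (\<Sum>j\<in>dom Z. gain P j (the (?Z j)))"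
      unfolding profit_def using i fin by simp
    also have "(\<Sum>j\<in>dom Z. gain P j (the (?Z j))) = profit P Z"
      unfolding profit_def using i by (intro sum.cong) auto
    finally have "profit P Z \<le> profit P Z'" using Z'(2) gain_nonneg[OF i(1) b(1)] by linarith
    with Z'(1) show ?thesis by blast
  qed auto
qed

lemma realizes_exists:
  assumes "cost P S \<le> card (students P)"
  shows "\<exists>A. realizes P S A"
proof -
  have "capped P S Map.empty"
    by (simp add: capped_def assignment_def assigned_def)
  then show ?thesis using capped_imp_realizes assms by blast
qed

lemma finite_profits: "finite {profit P A | A. realizes P S A}"
proof -
  have "{profit P A | A. realizes P S A} \<subseteq> profit P ` {A. assignment P A}"
    by (auto simp: realizes_def)
  then show ?thesis using finite_assignments finite_surj by blast
qed

lemma selection_profit_attained: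
  assumes "cost P S \<le> card (students P)"
  obtains A where "realizes P S A" "profit P A = selection_profit P S"
proof -
  have "selection_profit P S \<in> {profit P A | A. realizes P S A}"
    unfolding selection_profit_def using realizes_exists[OF assms]
    by (intro Max_in finite_profits) auto
  then show ?thesis using that by auto
qed

lemma profit_le_selection_profit:
  assumes "capped P S A" "cost P S \<le> card (students P)"
  shows "profit P A \<le> selection_profit P S"
proof -
  obtain A' where A': "realizes P S A'" "profit P A \<le> profit P A'"
    using capped_imp_realizes assms by blast
  then have "profit P A' \<le> selection_profit P S"
    unfolding selection_profit_def by (intro Max_ge finite_profits) auto
  with A' show ?thesis by simp
qed

lemma selection_profit_mono:
  assumes "\<And>b. b \<in> seminars P \<Longrightarrow> S b \<le> T b" "cost P T \<le> card (students P)"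
  shows "selection_profit P S \<le> selection_profit P T"
proof -
  have "cost P S \<le> cost P T" unfolding cost_def using assms(1) by (rule sum_mono)
  then obtain A where "realizes P S A" "profit P A = selection_profit P S"
    using assms(2) selection_profit_attained by (metis le_trans)
  then show ?thesis
    using profit_le_selection_profit[OF capped_mono[OF realizes_capped]] assms by metis
qed

section \<open>Mixing two assignments and diminishing returns\<close>

text \<open>The change of profit is additive in \<open>C\<close>; this is what allows the changes on
  disjoint switching sets to be summed.\<close>

lemma profit_mix:
  assumes "assignment P X" "assignment P Y"
  shows "profit P (mix C Y X) =
    profit P X + (\<Sum>i\<in>students P \<inter> C. value_of P Y i - value_of P X i)"
proof -
  have "profit P (mix C Y X) = (\<Sum>i\<in>students P. value_of P (mix C Y X) i)"
    using assms by (intro profit_eq_sum_value_of assignment_mix)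
  also have "\<dots> = (\<Sum>i\<in>students P. value_of P X i +
      (if i \<in> C then value_of P Y i - value_of P X i else 0))"
    by (intro sum.cong) (auto simp: value_of_def mix_def)
  also have "\<dots> = profit P X + (\<Sum>i\<in>students P \<inter> C. value_of P Y i - value_of P X i)"
    using assms finite_students
    by (simp add: sum.distrib profit_eq_sum_value_of sum.inter_restrict)
  finally show ?thesis .
qed

text \<open>The maps \<open>h\<close> and \<open>k\<close> number the places of \<open>b\<close> in
  \<open>X\<close> and in \<open>Y\<close>. By \<open>closed\<close>, students sharing a place
  switch together, so sending each student of the mix to the place held after switching is injective
  into \<open>{..<n}\<close>.\<close>

lemma card_assigned_mix:
  assumes X: "assignment P X" and Y: "assignment P Y"
    and injX: "inj_on h (assigned X b)" and injY: "inj_on k (assigned Y b)"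
    and closed: "\<And>i j. i \<in> assigned X b \<Longrightarrow> j \<in> assigned Y b \<Longrightarrow> h i = k j \<Longrightarrow> i \<in> C \<longleftrightarrow> j \<in> C"
    and capX: "\<And>i. i \<in> assigned X b - C \<Longrightarrow> h i < (n :: nat)"
    and capY: "\<And>i. i \<in> assigned Y b \<inter> C \<Longrightarrow> k i < n"
  shows "card (assigned (mix C Y X) b) \<le> n"
proof -
  let ?f = "\<lambda>i. if i \<in> C then k i else h i"
  have eq: "assigned (mix C Y X) b = (assigned Y b \<inter> C) \<union> (assigned X b - C)"
    by (auto simp: assigned_def mix_def)
  have "inj_on ?f (assigned (mix C Y X) b)"
    unfolding eq
    by (intro inj_onI) (auto split: if_splits dest: inj_onD[OF injX] inj_onD[OF injY] closed closed[OF _ _ sym])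
  moreover have "?f ` assigned (mix C Y X) b \<subseteq> {..<n}"
    unfolding eq using capX capY by auto
  ultimately show ?thesis
    using card_inj_on_le[of ?f _ "{..<n}"] by simp
qed

text \<open>
  Number the places of each seminar, such that \<open>X\<close> uses only places below \<open>S b\<close>. Let \<open>(i, j) \<in> r\<close> if
  the place of \<open>i\<close> in \<open>X\<close> is that of \<open>j\<close> in \<open>Y\<close>; switching from \<open>X\<close> to \<open>Y\<close> on a union of
  connected components of \<open>r\<close> never assigns a place twice. Students whose place in \<open>Y\<close> is new are starting
  points of chains of \<open>r\<close>, so each component creates at most one new place. Switching on the
  components \<open>C b\<close> with a new place in \<open>b\<close> raises only the size of \<open>b\<close>, and switching on the remaining
  ones needs no new place.
\<close>

lemma profit_le_sum_marginals:
  assumes S: "cost P S \<le> card (students P)" and Y: "assignment P Y"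
    and fits: "\<And>b. b \<in> seminars P \<Longrightarrow> S b < card (assigned Y b) \<Longrightarrow>
      cost P (S(b := card (assigned Y b))) \<le> card (students P)"
  shows "profit P Y \<le> selection_profit P S +
    (\<Sum>b | b \<in> seminars P \<and> S b < card (assigned Y b).
      selection_profit P (S(b := card (assigned Y b))) - selection_profit P S)"
proof -
  obtain X where X: "realizes P S X" and pX: "profit P X = selection_profit P S"
    using selection_profit_attained[OF S] .
  have asX: "assignment P X" using X by (simp add: realizes_def)
  have "\<exists>h. bij_betw h (assigned A b) {..<card (assigned A b)}" if "assignment P A" for A b
    using finite_assigned[OF that, of b] ex_bij_betw_finite_nat atLeast0LessThan by metis
  then have "\<exists>h. \<forall>b. bij_betw (h b) (assigned A b) {..<card (assigned A b)}"
    if "assignment P A" for A using that by metis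
  then obtain h k where h: "\<And>b. bij_betw (h b) (assigned X b) {..<card (assigned X b)}"
    and k: "\<And>b. bij_betw (k b) (assigned Y b) {..<card (assigned Y b)}"
    using asX Y by metis
  define r where "r = {(i, j). \<exists>b. i \<in> assigned X b \<and> j \<in> assigned Y b \<and> h b i = k b j}"
  \<comment> \<open>Forward reachability already gives whole components: by \<open>r_inj\<close>
    predecessors are unique, and by \<open>start\<close> the new places begin chains.\<close>
  define C where "C b = r\<^sup>* `` {i \<in> assigned Y b. S b \<le> k b i}" for b
  define B where "B = {b \<in> seminars P. S b < card (assigned Y b)}"
  have same: "b = c" if "i \<in> assigned A b" "i \<in> assigned A c" for i b c and A :: "'i \<rightharpoonup> 'b"
    using that by (simp add: assigned_def)
  have sem: "b \<in> seminars P" if "i \<in> assigned X b" for i b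
    using asX that by (auto simp: assignment_def assigned_def ran_def)
  have semY: "b \<in> seminars P" if "i \<in> assigned Y b" for i b
    using Y that by (auto simp: assignment_def assigned_def ran_def)
  have hlt: "h b i < S b" if "i \<in> assigned X b" for i b
    using bij_betwE[OF h] that X sem[OF that] by (fastforce simp: realizes_def)
  have klt: "k b i < card (assigned Y b)" if "i \<in> assigned Y b" for i b
    using bij_betwE[OF k] that by fastforce
  have r_inj: "i = i'" if "(i, j) \<in> r" "(i', j) \<in> r" for i i' j
    using that same bij_betw_imp_inj_on[OF h] unfolding r_def inj_on_def
    by simp metis
  have start: "(j, i) \<notin> r" if "i \<in> assigned Y b" "S b \<le> k b i" for i j b
    using that hlt same unfolding r_def by simp (metis not_le)
  have closed: "i \<in> C b \<longleftrightarrow> j \<in> C b" if "(i, j) \<in> r" for i j b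
  proof
    show "j \<in> C b" if "i \<in> C b"
      using that \<open>(i, j) \<in> r\<close> by (auto simp: C_def intro: rtrancl.rtrancl_into_rtrancl)
    assume "j \<in> C b"
    then obtain s where s: "s \<in> assigned Y b" "S b \<le> k b s" "(s, j) \<in> r\<^sup>*"
      by (auto simp: C_def)
    from s(3) show "i \<in> C b"
    proof (cases rule: rtranclE)
      case base
      then show ?thesis using start s that by blast
    next
      case (step i')
      then show ?thesis using r_inj[OF that] s by (auto simp: C_def)
    qed
  qed
  have disj: "b = c" if i: "i \<in> C b" "i \<in> C c" for i b c
  proof -
    obtain s t where s: "s \<in> assigned Y b" "S b \<le> k b s" "(s, i) \<in> r\<^sup>*"
      and t: "t \<in> assigned Y c" "S c \<le> k c t" "(t, i) \<in> r\<^sup>*"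
      using i by (auto simp: C_def)
    \<comment> \<open>Walking backwards from \<open>i\<close> is deterministic, so one of the two
      starting points lies on the backward walk from the other; neither has a predecessor, so they
      coincide.\<close>
    have "single_valued (r\<inverse>)"
      using r_inj by (auto intro: single_valuedI)
    moreover have "(i, s) \<in> (r\<inverse>)\<^sup>*" "(i, t) \<in> (r\<inverse>)\<^sup>*"
      using s t by (simp_all add: rtrancl_converse)
    ultimately have "(s, t) \<in> (r\<inverse>)\<^sup>* \<or> (t, s) \<in> (r\<inverse>)\<^sup>*"
      by (rule single_valued_confluent)
    then have "s = t"
      using start[OF s(1,2)] start[OF t(1,2)] by (auto simp: rtrancl_converse elim: rtranclE)
    then show ?thesis using s t same by blast
  qed
  have capped_mix: "capped P T (mix D Y X)"
    if D: "\<And>i j. (i, j) \<in> r \<Longrightarrow> i \<in> D \<longleftrightarrow> j \<in> D"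
      and ST: "\<And>b. b \<in> seminars P \<Longrightarrow> S b \<le> T b"
      and kT: "\<And>b i. i \<in> assigned Y b \<Longrightarrow> i \<in> D \<Longrightarrow> k b i < T b" for T D
    unfolding capped_def
  proof (intro conjI ballI)
    show "card (assigned (mix D Y X) b) \<le> T b" if "b \<in> seminars P" for b
      using hlt[of _ b] ST[OF that] kT
      by (intro card_assigned_mix[OF asX Y bij_betw_imp_inj_on[OF h] bij_betw_imp_inj_on[OF k]] D)
        (auto simp: r_def intro: less_le_trans)
  qed (simp add: asX Y assignment_mix)
  let ?d = "\<lambda>i. value_of P Y i - value_of P X i"
  let ?E = "- (\<Union>b\<in>B. C b)"
  have marginal: "(\<Sum>i\<in>students P \<inter> C b. ?d i)
      \<le> selection_profit P (S(b := card (assigned Y b))) - selection_profit P S" if "b \<in> B" for b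
  proof -
    have "capped P (S(b := card (assigned Y b))) (mix (C b) Y X)"
    proof (rule capped_mix)
      fix c i assume i: "i \<in> assigned Y c" "i \<in> C b"
      show "k c i < (S(b := card (assigned Y b))) c"
      proof (cases "S c \<le> k c i")
        case True
        then have "i \<in> C c" using i by (auto simp: C_def)
        then show ?thesis using disj i klt by fastforce
      next
        case False
        then show ?thesis using klt i by auto
      qed
    qed (use closed that in \<open>auto simp: B_def\<close>)
    then have "profit P (mix (C b) Y X) \<le> selection_profit P (S(b := card (assigned Y b)))"
      using fits that by (intro profit_le_selection_profit) (auto simp: B_def)
    then show ?thesis using profit_mix[OF asX Y] pX by simp
  qed
  \<comment> \<open>The complement of the sets \<open>C b\<close> is again closed under
    \<open>r\<close>, and it contains no student with a new place in \<open>Y\<close>.\<close>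
  have "capped P S (mix ?E Y X)"
  proof (rule capped_mix)
    fix b i assume i: "i \<in> assigned Y b" "i \<in> ?E"
    show "k b i < S b"
    proof (rule ccontr)
      assume "\<not> k b i < S b"
      then have "b \<in> B" and "i \<in> C b"
        using i(1) klt[OF i(1)] semY[OF i(1)] by (auto simp: B_def C_def not_less)
      then show False using i(2) by blast
    qed
  qed (use closed in auto)
  then have "profit P (mix ?E Y X) \<le> selection_profit P S"
    using S by (intro profit_le_selection_profit)
  then have rest: "(\<Sum>i\<in>students P \<inter> ?E. ?d i) \<le> 0"
    using profit_mix[OF asX Y] pX by simp
  have "profit P Y - selection_profit P S = (\<Sum>i\<in>students P. ?d i)"
    using asX Y pX by (simp add: profit_eq_sum_value_of sum_subtractf)
  also have "students P = (students P \<inter> ?E) \<union> (\<Union>b\<in>B. students P \<inter> C b)"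
    by auto
  also have "(\<Sum>i\<in>\<dots>. ?d i) = (\<Sum>i\<in>students P \<inter> ?E. ?d i) + (\<Sum>i\<in>(\<Union>b\<in>B. students P \<inter> C b). ?d i)"
    using finite_students finite_seminars by (intro sum.union_disjoint) (auto simp: B_def)
  also have "(\<Sum>i\<in>(\<Union>b\<in>B. students P \<inter> C b). ?d i) = (\<Sum>b\<in>B. \<Sum>i\<in>students P \<inter> C b. ?d i)"
    using finite_students finite_seminars disj
    by (intro sum.UNION_disjoint) (auto simp: B_def)
  also have "\<dots> \<le> (\<Sum>b\<in>B. selection_profit P (S(b := card (assigned Y b))) - selection_profit P S)"
    by (rule sum_mono) (rule marginal)
  finally show ?thesis using rest unfolding B_def by linarith
qed

section \<open>Increments of a selection, termination and output of greedy runs\<close>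

lemma cost_fun_upd:
  assumes "b \<in> seminars P"
  shows "cost P (S(b := n)) + S b = cost P S + n"
proof -
  have "(\<Sum>c\<in>seminars P. (S(b := n)) c) = n + (\<Sum>c\<in>seminars P - {b}. S c)"
    using assms finite_seminars by (simp add: sum.remove)
  then show ?thesis unfolding cost_def using sum.remove[OF finite_seminars assms, of S] by simp
qed

lemma inc_fun_upd:
  assumes "feasible_selection P S" "b \<in> seminars P" "n \<in> sizes P b" "S b < n"
    "cost P (S(b := n)) \<le> card (students P)"
  shows "S(b := n) \<in> inc P S"
  using assms unfolding inc_def feasible_selection_def selection_def strictly_extends_def
  by (auto intro!: exI[of _ b] bexI[of _ b] simp: PiE_def extensional_def)

lemma finite_inc: "finite (inc P S)"
proof -
  have "inc P S \<subseteq> (\<Pi>\<^sub>E b\<in>seminars P. {..card (students P)})"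
  proof
    fix T assume "T \<in> inc P S"
    then have T: "T \<in> extensional (seminars P)" "cost P T \<le> card (students P)"
      by (auto simp: inc_def feasible_selection_def selection_def PiE_def)
    moreover have "T b \<le> cost P T" if "b \<in> seminars P" for b
      unfolding cost_def using that finite_seminars by (intro member_le_sum) auto
    ultimately show "T \<in> (\<Pi>\<^sub>E b\<in>seminars P. {..card (students P)})"
      by (force simp: PiE_def Pi_def)
  qed
  then show ?thesis
    by (rule finite_subset) (auto intro!: finite_PiE finite_seminars)
qed

lemma ex_is_arg_max:
  assumes "finite {x. Q x}" "\<exists>x. Q x"
  shows "\<exists>x. is_arg_max (f :: 'z \<Rightarrow> real) Q x"
proof -
  have "Max (f ` {x. Q x}) \<in> f ` {x. Q x}" using assms by (intro Max_in) auto
  then obtain x where "Q x" "f x = Max (f ` {x. Q x})" by auto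
  then show ?thesis using assms unfolding is_arg_max_def
    by (intro exI[of _ x]) (auto simp: not_less)
qed

lemma greedy_step_inc: "greedy_step P S T \<Longrightarrow> T \<in> inc P S"
  by (simp add: greedy_step_def is_arg_max_def)

lemma inc_feasible: "T \<in> inc P S \<Longrightarrow> feasible_selection P T"
  by (simp add: inc_def)

lemma inc_ge: "T \<in> inc P S \<Longrightarrow> b \<in> seminars P \<Longrightarrow> S b \<le> T b"
  by (simp add: inc_def strictly_extends_def)

lemma inc_cost: "T \<in> inc P S \<Longrightarrow> cost P S < cost P T"
  unfolding inc_def cost_def strictly_extends_def using finite_seminars
  by (intro sum_strict_mono_ex1) auto

lemma feasible_cost: "feasible_selection P S \<Longrightarrow> cost P S \<le> card (students P)"
  by (simp add: feasible_selection_def)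

lemma greedy_terminates: "greedy_terminates P S0"
  unfolding greedy_terminates_def
proof safe
  fix S :: "nat \<Rightarrow> 'b \<Rightarrow> nat"
  assume step: "\<forall>n. greedy_step P (S n) (S (Suc n))"
  \<comment> \<open>Costs strictly increase along a run, while feasibility bounds them by the number
    of students.\<close>
  have "n \<le> cost P (S n)" for n
  proof (induction n)
    case (Suc n)
    then show ?case using inc_cost greedy_step_inc step by (metis Suc_leI le_less_trans)
  qed simp
  moreover have "cost P (S (Suc n)) \<le> card (students P)" for n
    using step greedy_step_inc inc_feasible feasible_cost by metis
  ultimately show False by (metis Suc_n_not_le_n le_trans)
qed

lemma greedy_final_exists: "feasible_selection P S \<Longrightarrow> \<exists>T. greedy_final P S T"
proof (induction "card (students P) - cost P S" arbitrary: S rule: less_induct)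
  case less
  show ?case
  proof (cases "inc P S = {}")
    case True
    then show ?thesis by (auto simp: greedy_final_def)
  next
    case False
    then obtain T where T: "greedy_step P S T"
      using ex_is_arg_max[of "\<lambda>T. T \<in> inc P S"] finite_inc by (auto simp: greedy_step_def)
    have "card (students P) - cost P T < card (students P) - cost P S"
      using inc_cost[OF greedy_step_inc[OF T]]
        feasible_cost[OF inc_feasible[OF greedy_step_inc[OF T]]] by simp
    then obtain U where "greedy_final P T U"
      using less.hyps inc_feasible[OF greedy_step_inc[OF T]] by blast
    then show ?thesis using T unfolding greedy_final_def
      by (metis converse_rtranclp_into_rtranclp)
  qed
qed

lemma greedy_rtrancl_feasible:
  assumes "(greedy_step P)\<^sup>*\<^sup>* S0 S" "feasible_selection P S0"
  shows "feasible_selection P S"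
  using assms by induction (auto dest: greedy_step_inc inc_feasible)

lemma realizes_feasible:
  "feasible_selection P S \<Longrightarrow> realizes P S A \<Longrightarrow> feasible_assignment P A"
  by (auto simp: feasible_selection_def selection_def realizes_def feasible_assignment_def)

lemma greedy_output_exists:
  assumes "feasible_selection P S0"
  shows "\<exists>A. greedy_output P S0 A"
proof -
  obtain S where S: "greedy_final P S0 S" using greedy_final_exists[OF assms] by blast
  then have "cost P S \<le> card (students P)"
    using greedy_rtrancl_feasible assms feasible_cost by (auto simp: greedy_final_def)
  moreover have "finite {A. realizes P S A}"
    using finite_assignments by (rule rev_finite_subset) (auto simp: realizes_def)
  ultimately obtain A1 where A1: "is_arg_max (profit P) (realizes P S) A1"
    using ex_is_arg_max[of "realizes P S" "profit P"] realizes_exists[of S] by auto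
  show ?thesis
  proof (cases "\<exists>b\<in>seminars P. S0 b = 0")
    case True
    have "finite {A. single_seminar_assignment P S0 A}"
      using finite_assignments by (rule rev_finite_subset)
        (auto simp: single_seminar_assignment_def feasible_assignment_def)
    moreover have "single_seminar_assignment P S0 Map.empty"
      using True inst by (auto simp: single_seminar_assignment_def feasible_assignment_def
          assignment_def assigned_def sap_instance_def)
    ultimately obtain A2 where A2: "is_arg_max (profit P) (single_seminar_assignment P S0) A2"
      using ex_is_arg_max[of "single_seminar_assignment P S0" "profit P"] by auto
    obtain A where "is_arg_max (profit P) (\<lambda>A'. A' \<in> {A1, A2}) A"
      using ex_is_arg_max[of "\<lambda>A'. A' \<in> {A1, A2}"] by auto
    then show ?thesis using True S A1 A2 unfolding greedy_output_def by auto
  next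
    case False
    show ?thesis using S A1 unfolding greedy_output_def if_not_P[OF False] by blast
  qed
qed

text \<open>Both candidates are feasible and the output is at least as good as \<open>A1\<close>, so
  a bound on \<open>selection_profit\<close> of the final selection suffices.\<close>

lemma greedy_output_cases:
  assumes "greedy_output P S0 A" "feasible_selection P S0"
  obtains S where "greedy_final P S0 S" "feasible_assignment P A"
    "selection_profit P S \<le> profit P A"
proof -
  obtain S A1 where S: "greedy_final P S0 S" and A1: "is_arg_max (profit P) (realizes P S) A1"
    and A: "if \<exists>b\<in>seminars P. S0 b = 0
         then \<exists>A2. is_arg_max (profit P) (single_seminar_assignment P S0) A2 \<and>
                is_arg_max (profit P) (\<lambda>A'. A' \<in> {A1, A2}) A
         else A = A1"
    using assms(1) unfolding greedy_output_def by blast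
  have fS: "feasible_selection P S"
    using S greedy_rtrancl_feasible assms by (auto simp: greedy_final_def)
  have A1': "realizes P S A1" using A1 by (simp add: is_arg_max_def)
  obtain A' where "realizes P S A'" "profit P A' = selection_profit P S"
    using selection_profit_attained[OF feasible_cost[OF fS]] .
  then have p1: "selection_profit P S \<le> profit P A1"
    using A1 by (auto simp: is_arg_max_def not_less)
  have "feasible_assignment P A \<and> profit P A1 \<le> profit P A"
    using A realizes_feasible[OF fS A1']
    by (auto simp: is_arg_max_def single_seminar_assignment_def not_less split: if_splits)
  with p1 S that show thesis by auto
qed

section \<open>Decrease of the gap in one greedy step\<close>

text \<open>Every raise to the size in \<open>Y\<close> competes with \<open>T\<close>, so its ratio
  is at most that of \<open>T\<close>. Summing the marginal gains bounds the gap by this ratio times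
  \<open>L\<close>, and \<open>1 - x \<le> exp (- x)\<close> gives the factor. The
  \<open>max 0\<close> covers a gap that is already closed.\<close>

lemma greedy_step_gap:
  assumes S: "feasible_selection P S" and step: "greedy_step P S T"
    and Y: "feasible_assignment P Y"
    and fits: "\<And>b. b \<in> seminars P \<Longrightarrow> S b < card (assigned Y b) \<Longrightarrow>
      cost P (S(b := card (assigned Y b))) \<le> card (students P)"
    and L: "(\<Sum>b | b \<in> seminars P \<and> S b < card (assigned Y b). card (assigned Y b)) \<le> L"
  shows "profit P Y - selection_profit P T \<le>
    exp (- (real (cost P T - cost P S) / real L)) * max 0 (profit P Y - selection_profit P S)"
proof -
  let ?B = "{b \<in> seminars P. S b < card (assigned Y b)}"
  let ?T = "\<lambda>b. S(b := card (assigned Y b))"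
  define \<rho> where "\<rho> = incremental_ratio P S T"
  have asY: "assignment P Y" using Y by (simp add: feasible_assignment_def)
  have T: "T \<in> inc P S" using greedy_step_inc[OF step] .
  have cT: "cost P S < cost P T" using inc_cost[OF T] .
  have mono: "selection_profit P S \<le> selection_profit P T"
    using inc_ge[OF T] feasible_cost[OF inc_feasible[OF T]] by (rule selection_profit_mono)
  have \<rho>: "selection_profit P T - selection_profit P S = \<rho> * real (cost P T - cost P S)"
    using cT by (simp add: \<rho>_def incremental_ratio_def of_nat_diff)
  have \<rho>0: "0 \<le> \<rho>" using cT mono by (simp add: \<rho>_def incremental_ratio_def)
  have each: "selection_profit P (?T b) - selection_profit P S \<le> \<rho> * real (card (assigned Y b))"
    if "b \<in> ?B" for b
  proof -
    have "?T b \<in> inc P S"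
      using that S Y fits by (intro inc_fun_upd) (auto simp: feasible_assignment_def)
    then have "incremental_ratio P S (?T b) \<le> \<rho>"
      using step unfolding greedy_step_def \<rho>_def is_arg_max_def by (auto simp: not_less)
    moreover have c: "cost P S < cost P (?T b)" "cost P (?T b) \<le> cost P S + card (assigned Y b)"
      using cost_fun_upd[of b S "card (assigned Y b)"] that by auto
    ultimately have "selection_profit P (?T b) - selection_profit P S
        \<le> \<rho> * (real (cost P (?T b)) - real (cost P S))"
      by (simp add: incremental_ratio_def divide_simps)
    also have "\<dots> \<le> \<rho> * real (card (assigned Y b))"
      using \<rho>0 c by (intro mult_left_mono) linarith+
    finally show ?thesis .
  qed
  have "profit P Y - selection_profit P S \<le> (\<Sum>b\<in>?B. selection_profit P (?T b) - selection_profit P S)"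
    using profit_le_sum_marginals[OF feasible_cost[OF S] asY fits] by simp
  also have "\<dots> \<le> (\<Sum>b\<in>?B. \<rho> * real (card (assigned Y b)))"
    by (rule sum_mono) (rule each)
  also have "\<dots> = \<rho> * real (\<Sum>b\<in>?B. card (assigned Y b))"
    by (simp add: sum_distrib_left)
  also have "\<dots> \<le> \<rho> * real L"
    using L \<rho>0 by (intro mult_left_mono) (simp_all only: of_nat_le_iff)
  finally have gap: "profit P Y - selection_profit P S \<le> \<rho> * real L" .
  show ?thesis
  proof (cases "profit P Y \<le> selection_profit P S")
    case True
    then show ?thesis using mono by simp
  next
    case False
    let ?D = "profit P Y - selection_profit P S" and ?c = "real (cost P T - cost P S)"
    \<comment> \<open>For \<open>L = 0\<close> the bound on the gap would make it
      nonpositive.\<close>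
    have L0: "0 < L" using gap False by (cases "L = 0") auto
    have "?D / L \<le> \<rho>" using gap L0 by (simp add: divide_simps)
    then have "?D / L * ?c \<le> \<rho> * ?c" by (rule mult_right_mono) simp
    then have "profit P Y - selection_profit P T \<le> ?D * (1 + - (?c / L))"
      using \<rho> by (simp add: algebra_simps)
    also have "\<dots> \<le> ?D * exp (- (?c / L))"
      using False by (intro mult_left_mono exp_ge_add_one_self) simp
    finally show ?thesis using False by (simp add: mult.commute)
  qed
qed

section \<open>Restricted optima and the approximation guarantee\<close>

text \<open>Used with the three top seminars, to bound the initial profit, and with the complement
  of a single seminar, to drop a blocked one from the optimum.\<close>

definition restrict_seminars :: "'b set \<Rightarrow> ('i \<rightharpoonup> 'b) \<Rightarrow> ('i \<rightharpoonup> 'b)" where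
  "restrict_seminars D A = (\<lambda>i. if A i \<in> Some ` D then A i else None)"

lemma assigned_restrict_seminars:
  "assigned (restrict_seminars D A) b = (if b \<in> D then assigned A b else {})"
  by (auto simp: assigned_def restrict_seminars_def)

lemma assignment_restrict_seminars: "assignment P A \<Longrightarrow> assignment P (restrict_seminars D A)"
  by (auto simp: assignment_def restrict_seminars_def dom_def ran_def split: if_splits)

lemma profit_restrict_seminars:
  assumes "assignment P A"
  shows "profit P (restrict_seminars D A) = (\<Sum>b\<in>seminars P \<inter> D. seminar_profit P A b)"
  using finite_seminars
  by (auto simp: profit_eq_sum_seminar_profit[OF assignment_restrict_seminars[OF assms]]
      sum.inter_restrict seminar_profit_def assigned_restrict_seminars intro!: sum.cong)

lemma feasible_restrict_seminars:
  "feasible_assignment P A \<Longrightarrow> feasible_assignment P (restrict_seminars D A)"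
  using inst by (auto simp: feasible_assignment_def assignment_restrict_seminars
      assigned_restrict_seminars sap_instance_def)

text \<open>Along the run, either the desired bound \<open>?good\<close> holds or no blocked seminar
  has yet spoiled the exponential decay \<open>near\<close>. The former persists because profits
  only grow; the final selection either covers \<open>A\<close> or has a blocked seminar.\<close>

lemma greedy_guarantee:
  fixes A :: "'i \<rightharpoonup> 'b" and D :: "'b set"
  defines "S0 \<equiv> (\<lambda>b\<in>seminars P. if b \<in> D then card (assigned A b) else 0)"
  assumes A: "feasible_assignment P A" and D: "D \<subseteq> seminars P" "card D = 3"
    and top: "\<And>b b'. b \<in> seminars P - D \<Longrightarrow> b' \<in> D \<Longrightarrow>
      seminar_profit P A b \<le> seminar_profit P A b'"
  shows "feasible_selection P S0"
    and "greedy_final P S0 S \<Longrightarrow> (1 - exp (- 1)) * profit P A \<le> selection_profit P S"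
proof -
  let ?o = "\<lambda>b. card (assigned A b)" and ?u = "exp (- 1 :: real)"
  let ?good = "\<lambda>S. (1 - ?u) * profit P A \<le> selection_profit P S"
  define Y where "Y b = restrict_seminars (- {b}) A" for b
  define L where "L b = (\<Sum>c\<in>seminars P - D - {b}. ?o c)" for b
  define G where "G = selection_profit P S0"
  \<comment> \<open>The decay is tracked for all \<open>b\<close> outside \<open>D\<close> at once,
    since the seminar that gets blocked is not known in advance. If \<open>L b = 0\<close>, division
    by zero makes the factor 1.\<close>
  define near where "near S \<longleftrightarrow> (\<forall>b\<in>seminars P - D. profit P (Y b) - selection_profit P S
      \<le> exp (- (real (cost P S - cost P S0) / real (L b))) * max 0 (profit P (Y b) - G))" for S
  have asA: "assignment P A" using A by (simp add: feasible_assignment_def)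
  have oA: "(\<Sum>b\<in>seminars P. ?o b) \<le> card (students P)"
    using card_dom[OF asA] asA card_mono[OF finite_students] unfolding assignment_def by metis
  have cS0: "cost P S0 = (\<Sum>b\<in>D. ?o b)"
    unfolding cost_def S0_def using D finite_seminars by (simp add: sum.inter_restrict[symmetric] Int_absorb1)
  have "cost P S0 \<le> (\<Sum>b\<in>seminars P. ?o b)"
    unfolding cS0 using D finite_seminars by (intro sum_mono2) auto
  then show f0: "feasible_selection P S0"
    using A oA inst unfolding feasible_selection_def selection_def S0_def
    by (auto simp: feasible_assignment_def sap_instance_def)
  have p0: "(\<Sum>b\<in>D. seminar_profit P A b) \<le> G"
  proof -
    have "capped P S0 (restrict_seminars D A)"
      by (simp add: capped_def assignment_restrict_seminars[OF asA] assigned_restrict_seminars S0_def)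
    then have "profit P (restrict_seminars D A) \<le> G"
      unfolding G_def using feasible_cost[OF f0] by (rule profit_le_selection_profit)
    then show ?thesis using D by (simp add: profit_restrict_seminars[OF asA] Int_absorb1)
  qed
  have third: "3 * seminar_profit P A b \<le> G" if "b \<in> seminars P - D" for b
  proof -
    have "3 * seminar_profit P A b = (\<Sum>b'\<in>D. seminar_profit P A b)" using D by simp
    also have "\<dots> \<le> (\<Sum>b'\<in>D. seminar_profit P A b')" using top that by (intro sum_mono)
    finally show ?thesis using p0 by simp
  qed
  have G0: "0 \<le> G"
    using p0 sum_nonneg[of D "seminar_profit P A"] seminar_profit_nonneg[OF asA] D by fastforce
  have pY: "profit P A = profit P (Y b) + seminar_profit P A b" if "b \<in> seminars P" for b
    using that finite_seminars
    by (simp add: Y_def profit_restrict_seminars[OF asA] profit_eq_sum_seminar_profit[OF asA]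
        sum.remove Diff_eq)
  have u: "1 / 3 \<le> ?u" "?u \<le> 1"
    using exp_le by (simp_all add: exp_minus field_simps)
  have blocked: "?good S"
    if S: "feasible_selection P S" and ge: "\<And>b. b \<in> seminars P \<Longrightarrow> S0 b \<le> S b" and near: "near S"
      and b: "b \<in> seminars P" "S b < ?o b" "card (students P) < cost P (S(b := ?o b))" for S b
  proof -
    \<comment> \<open>Seminars in \<open>D\<close> start at their optimal size and never
      shrink.\<close>
    have bD: "b \<in> seminars P - D" using b ge[OF b(1)] by (auto simp: S0_def)
    have "(\<Sum>c\<in>seminars P. ?o c) = cost P S0 + (\<Sum>c\<in>seminars P - D. ?o c)"
      unfolding cS0 using D finite_seminars by (metis add.commute sum.subset_diff)
    also have "(\<Sum>c\<in>seminars P - D. ?o c) = ?o b + L b"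
      unfolding L_def using bD finite_seminars by (intro sum.remove) auto
    \<comment> \<open>The optimal sizes together fit into the set of students, but raising
      \<open>b\<close> does not; so at least \<open>L b\<close> has been spent since
      \<open>S0\<close>.\<close>
    finally have c: "L b \<le> cost P S - cost P S0"
      using b(3) oA cost_fun_upd[OF b(1), of S "?o b"] by linarith
    have GS: "G \<le> selection_profit P S"
      unfolding G_def using ge feasible_cost[OF S] by (rule selection_profit_mono)
    let ?y = "profit P (Y b)" and ?q = "seminar_profit P A b"
    have q: "0 \<le> ?q" "3 * ?q \<le> G" using third[OF bD] seminar_profit_nonneg[OF asA b(1)] by auto
    have "(1 - ?u) * ?q \<le> (2 / 3) * ?q" using u q by (intro mult_right_mono) auto
    moreover have "G / 3 \<le> ?u * G" using mult_right_mono[OF u(1) G0] by simp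
    \<comment> \<open>The loss from dropping \<open>b\<close> is paid for by the share of the
      initial profit: \<open>(1 - ?u) * ?q\<close> is at most \<open>2 * G / 9\<close>, and
      \<open>?u * G\<close> is at least \<open>G / 3\<close>.\<close>
    ultimately have slack: "(1 - ?u) * ?q \<le> ?u * G" using q G0 by linarith
    show ?thesis
    proof (cases "?y \<le> G")
      case True
      have "(1 - ?u) * profit P A \<le> (1 - ?u) * (G + ?q)"
        using True pY[OF b(1)] u by (intro mult_left_mono) auto
      also have "\<dots> \<le> G" using slack by (simp add: algebra_simps)
      finally show ?thesis using GS by simp
    next
      case False
      \<comment> \<open>If \<open>L b = 0\<close>, then \<open>Y b\<close> only uses seminars in
        \<open>D\<close>, so its profit is at most \<open>G\<close>.\<close>
      have L0: "0 < L b"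
      proof (rule ccontr)
        assume "\<not> 0 < L b"
        then have "capped P S0 (Y b)"
          using asA finite_seminars
          by (auto simp: capped_def Y_def assignment_restrict_seminars
              assigned_restrict_seminars S0_def L_def)
        then have "?y \<le> G"
          unfolding G_def using feasible_cost[OF f0] by (rule profit_le_selection_profit)
        then show False using False by simp
      qed
      have "?y - selection_profit P S
          \<le> exp (- (real (cost P S - cost P S0) / real (L b))) * (?y - G)"
        using bspec[OF near[unfolded near_def] bD] False by (simp add: max_absorb2)
      also have "\<dots> \<le> ?u * (?y - G)"
        using c L0 False by (intro mult_right_mono) (simp_all add: divide_simps)
      finally have "(1 - ?u) * ?y + ?u * G \<le> selection_profit P S" by (simp add: algebra_simps)
      then show ?thesis using slack pY[OF b(1)] by (simp add: algebra_simps)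
    qed
  qed
  have inv: "(\<forall>b\<in>seminars P. S0 b \<le> S b) \<and> (?good S \<or> near S)"
    if "(greedy_step P)\<^sup>*\<^sup>* S0 S" for S
    using that
  proof induction
    case base
    then show ?case by (simp add: near_def G_def)
  next
    case (step S T)
    have S: "feasible_selection P S" using greedy_rtrancl_feasible[OF step(1) f0] .
    have T: "T \<in> inc P S" using greedy_step_inc[OF step(2)] .
    have ST: "selection_profit P S \<le> selection_profit P T"
      using inc_ge[OF T] feasible_cost[OF inc_feasible[OF T]] by (rule selection_profit_mono)
    have ge: "\<forall>b\<in>seminars P. S0 b \<le> S b" using step by blast
    have ge': "\<forall>b\<in>seminars P. S0 b \<le> T b" using ge inc_ge[OF T] le_trans by blast
    have "near T" if ng: "\<not> ?good S"
      unfolding near_def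
    proof
      have nS: "near S" using ng step by blast
      fix b assume b: "b \<in> seminars P - D"
      let ?y = "profit P (Y b)"
      have card_Y: "card (assigned (Y b) c) = (if c = b then 0 else ?o c)" for c
        by (simp add: Y_def assigned_restrict_seminars)
      have "(\<Sum>c | c \<in> seminars P \<and> S c < card (assigned (Y b) c). card (assigned (Y b) c))
        = (\<Sum>c | c \<in> seminars P \<and> S c < card (assigned (Y b) c). ?o c)"
        by (intro sum.cong) (auto simp: card_Y)
      \<comment> \<open>Seminars in \<open>D\<close> are already at their optimal size and
        \<open>b\<close> is empty in \<open>Y b\<close>, so neither occurs in the sum.\<close>
      also have "\<dots> \<le> L b"
        unfolding L_def using ge finite_seminars D
        by (intro sum_mono2) (fastforce simp: card_Y S0_def split: if_splits)+
      finally have L: "(\<Sum>c | c \<in> seminars P \<and> S c < card (assigned (Y b) c).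
        card (assigned (Y b) c)) \<le> L b" .
      \<comment> \<open>A raise that does not fit would give \<open>?good S\<close> by
        \<open>blocked\<close>.\<close>
      have "cost P (S(c := card (assigned (Y b) c))) \<le> card (students P)"
        if "c \<in> seminars P" "S c < card (assigned (Y b) c)" for c
        using blocked[OF S _ nS, of c] ge ng that by (force simp: card_Y split: if_splits)
      then have le: "?y - selection_profit P T \<le>
          exp (- (real (cost P T - cost P S) / real (L b))) * max 0 (?y - selection_profit P S)"
        using greedy_step_gap[OF S step(2) _ _ L] feasible_restrict_seminars[OF A]
        unfolding Y_def by blast
      have "max 0 (?y - selection_profit P S)
          \<le> exp (- (real (cost P S - cost P S0) / real (L b))) * max 0 (?y - G)"
        using nS b unfolding near_def by auto
      then have "exp (- (real (cost P T - cost P S) / real (L b))) * max 0 (?y - selection_profit P S)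
        \<le> exp (- (real (cost P T - cost P S) / real (L b))) *
          (exp (- (real (cost P S - cost P S0) / real (L b))) * max 0 (?y - G))"
        by (rule mult_left_mono) simp
      also have "\<dots> = exp (- (real (cost P T - cost P S) / real (L b)) -
          real (cost P S - cost P S0) / real (L b)) * max 0 (?y - G)"
        by (simp add: mult.assoc[symmetric] exp_add[symmetric])
      also have "- (real (cost P T - cost P S) / real (L b)) - real (cost P S - cost P S0) / real (L b)
          = - (real (cost P T - cost P S0) / real (L b))"
      proof -
        have "cost P S0 \<le> cost P S" unfolding cost_def using ge by (intro sum_mono) auto
        then have "cost P T - cost P S0 = (cost P T - cost P S) + (cost P S - cost P S0)"
          using inc_cost[OF T] by simp
        then show ?thesis by (simp add: add_divide_distrib)
      qed
      finally show "?y - selection_profit P T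
          \<le> exp (- (real (cost P T - cost P S0) / real (L b))) * max 0 (?y - G)"
        using le by linarith
    qed
    then show ?case using ge' ST by (cases "?good S") auto
  qed
  assume fin: "greedy_final P S0 S"
  then have S: "feasible_selection P S" and none: "inc P S = {}"
    using greedy_rtrancl_feasible f0 by (auto simp: greedy_final_def)
  from fin inv have ge: "\<And>b. b \<in> seminars P \<Longrightarrow> S0 b \<le> S b" and near: "?good S \<or> near S"
    by (auto simp: greedy_final_def)
  show "?good S"
  proof (cases "capped P S A")
    case True
    then have "profit P A \<le> selection_profit P S"
      using feasible_cost[OF S] by (rule profit_le_selection_profit)
    moreover have "0 \<le> profit P A"
      using seminar_profit_nonneg[OF asA]
      by (simp add: profit_eq_sum_seminar_profit[OF asA] sum_nonneg)
    then have "(1 - ?u) * profit P A \<le> 1 * profit P A" by (intro mult_right_mono) auto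
    ultimately show ?thesis by simp
  next
    case False
    then obtain b where b: "b \<in> seminars P" "S b < ?o b" using asA by (auto simp: capped_def not_le)
    \<comment> \<open>The size of \<open>b\<close> in \<open>A\<close> is allowable, so with no
      increment left the raise can fail only by cost.\<close>
    then have "card (students P) < cost P (S(b := ?o b))"
      using inc_fun_upd[OF S, of b "?o b"] none A by (auto simp: feasible_assignment_def not_le[symmetric])
    then show ?thesis using blocked[OF S ge] near b by blast
  qed
qed

end

theorem theorem5:
  fixes P :: "('i, 'b) sap"
    and A_opt :: "'i \<rightharpoonup> 'b"
    and b1 b2 b3 :: 'b
    and S_star :: "'b \<Rightarrow> nat"
  assumes "sap_instance P"
    and "optimal_assignment P A_opt"
    and "{b1, b2, b3} \<subseteq> seminars P"
    and "b1 \<noteq> b2" "b1 \<noteq> b3" "b2 \<noteq> b3"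
    and "\<forall>b\<in>seminars P - {b1, b2, b3}. \<forall>b'\<in>{b1, b2, b3}.
           seminar_profit P A_opt b \<le> seminar_profit P A_opt b'"
    and "S_star = (\<lambda>b\<in>seminars P. if b \<in> {b1, b2, b3} then card (assigned A_opt b) else 0)"
  shows "feasible_selection P S_star \<and>
    greedy_terminates P S_star \<and>
    (\<exists>A. greedy_output P S_star A) \<and>
    (\<forall>A. greedy_output P S_star A \<longrightarrow>
       feasible_assignment P A \<and> profit P A \<ge> (1 - exp (- 1)) * profit P A_opt)"
proof -
  have A: "feasible_assignment P A_opt"
    using assms(2) by (simp add: optimal_assignment_def is_arg_max_def)
  have c: "card {b1, b2, b3} = 3" using assms(4-6) by simp
  have top: "seminar_profit P A_opt b \<le> seminar_profit P A_opt b'"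
    if "b \<in> seminars P - {b1, b2, b3}" "b' \<in> {b1, b2, b3}" for b b'
    using assms(7) that by blast
  note guarantee = greedy_guarantee[OF assms(1) A assms(3) c top, folded assms(8)]
  have "feasible_assignment P A \<and> profit P A \<ge> (1 - exp (- 1)) * profit P A_opt"
    if "greedy_output P S_star A" for A
    using that
  proof (rule greedy_output_cases[OF assms(1) _ guarantee(1)])
    fix S
    assume "greedy_final P S_star S" "feasible_assignment P A" "selection_profit P S \<le> profit P A"
    then show ?thesis using guarantee(2)[of S] by linarith
  qed
  then show ?thesis
    using guarantee(1) greedy_terminates[OF assms(1)] greedy_output_exists[OF assms(1)] by blast
qed

end
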